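(* For $n\geq7$, $a_n(312,4321:123)=0$; that is, no permutation $\pi\in\mathcal{S}_n$ has the property that $\pi$ avoids $312$ and $4321$ and $\pi^2$ avoids $123$.
   Context: $\mathcal{S}_n$ is the set of permutations of $\{1,\ldots,n\}$ in one-line form; $\pi^2=\pi\circ\pi$. A permutation contains a pattern $\sigma\in\mathcal{S}_k$ if some subsequence of it (not necessarily consecutive) has the same relative order as $\sigma$; otherwise it avoids $\sigma$. $a_n(312,4321:\sigma)$ is the number of $\pi\in\mathcal{S}_n$ such that $\pi$ avoids both $312$ and $4321$ and $\pi^2$ avoids $\sigma$. *)

theory Defs
  imports "HOL-Combinatorics.Permutations"
begin

(* S_n is rendered as {p. p permutes {1..n}}: functions on nat that permute {1..n} and fix
   everything else, so composition of permutations is plain function composition.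

   A pattern is written in one-line form as a list with entries 1..k, so 312 is [3, 1, 2].
   Its positions are 0-based (list indexing), while those of p run over {1..n}.  The function f
   picks the positions of the not necessarily consecutive subsequence p (f 0), ..., p (f (k - 1)). *)
definition contains_pattern :: "nat \<Rightarrow> (nat \<Rightarrow> nat) \<Rightarrow> nat list \<Rightarrow> bool" where
  "contains_pattern n p \<sigma> \<longleftrightarrow>
     (\<exists>f. strict_mono_on {..<length \<sigma>} f \<and> f ` {..<length \<sigma>} \<subseteq> {1..n} \<and>
        (\<forall>i<length \<sigma>. \<forall>j<length \<sigma>. p (f i) < p (f j) \<longleftrightarrow> \<sigma> ! i < \<sigma> ! j))"

definition avoids_pattern :: "nat \<Rightarrow> (nat \<Rightarrow> nat) \<Rightarrow> nat list \<Rightarrow> bool" where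
  "avoids_pattern n p \<sigma> \<longleftrightarrow> \<not> contains_pattern n p \<sigma>"

(* avoid_count n T \<sigma> is a_n(T : \<sigma>): the patterns in T are avoided by p, the pattern \<sigma> by p^2. *)
definition avoid_count :: "nat \<Rightarrow> nat list set \<Rightarrow> nat list \<Rightarrow> nat" where
  "avoid_count n T \<sigma> =
     card {p. p permutes {1..n} \<and> (\<forall>\<tau>\<in>T. avoids_pattern n p \<tau>) \<and> avoids_pattern n (p \<circ> p) \<sigma>}"

end

theory Submission
  imports Defs
begin

text \<open>
  Avoiding both $312$ and $4321$ means that every entry of \<open>p\<close> has at most two smaller
  entries to its right: three of them would, avoiding $312$, be decreasing and complete a $4321$
  (\<open>no_three_smaller_later\<close>). In particular \<open>p i \<le> i + 2\<close>.

  Let \<open>p j = 1\<close>. Since \<open>p\<close> avoids $312$, all entries before the entry $1$ are smaller than all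
  entries after it, so \<open>p\<close> preserves \<open>{1..j}\<close> and \<open>{j+1..n}\<close>, and so does its square.

  If \<open>j < n\<close>, an ascent of the square inside one of the two intervals would extend to a $123$ by
  an entry of the other interval. Hence the square reverses both intervals. It moves a
  point up by at most $4$, so the intervals have at most five elements each; sizes four and
  five are excluded by looking at the few square roots of the reversal, whence \<open>n \<le> 6\<close>
  (\<open>early_one_bound\<close>).

  If \<open>j = n\<close>, the final $1$ is smaller than everything before it, so each earlier entry has at most one
  other smaller entry to its right. Reading \<open>p\<close> from the left, each entry is thus one of the two
  least values above $1$ that have not yet appeared. Following these binary choices, an
  increasing triple of the square is forced by \<open>p 1, ..., p 6\<close> in every branch
  (\<open>final_one_bound\<close>). Often only two of its entries are explicit: once the square
  has an ascent ending at position \<open>j\<close>, all larger values must stand before \<open>j\<close>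
  (\<open>larger_before_ascent\<close>), where there is not enough room for them.
\<close>

section \<open>Patterns as inequalities between entries\<close>

lemma avoids_312D:
  assumes "avoids_pattern n p [3, 1, 2]" "1 \<le> i" "i < j" "j < k" "k \<le> n" "p j < p k" "p k < p i"
  shows False
proof -
  have "contains_pattern n p [3, 1, 2]"
    unfolding contains_pattern_def
    by (rule exI[of _ "(!) [i, j, k]"])
      (use assms(2-) in \<open>auto simp: strict_mono_on_def less_Suc_eq numeral_eq_Suc\<close>)
  with assms(1) show False by (simp add: avoids_pattern_def)
qed

lemma avoids_4321D:
  assumes "avoids_pattern n p [4, 3, 2, 1]"
    "1 \<le> i" "i < j" "j < k" "k < l" "l \<le> n" "p l < p k" "p k < p j" "p j < p i"
  shows False
proof -
  have "contains_pattern n p [4, 3, 2, 1]"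
    unfolding contains_pattern_def
    by (rule exI[of _ "(!) [i, j, k, l]"])
      (use assms(2-) in \<open>auto simp: strict_mono_on_def less_Suc_eq numeral_eq_Suc\<close>)
  with assms(1) show False by (simp add: avoids_pattern_def)
qed

lemma avoids_123D:
  assumes "avoids_pattern n p [1, 2, 3]" "1 \<le> i" "i < j" "j < k" "k \<le> n" "p i < p j" "p j < p k"
  shows False
proof -
  have "contains_pattern n p [1, 2, 3]"
    unfolding contains_pattern_def
    by (rule exI[of _ "(!) [i, j, k]"])
      (use assms(2-) in \<open>auto simp: strict_mono_on_def less_Suc_eq numeral_eq_Suc\<close>)
  with assms(1) show False by (simp add: avoids_pattern_def)
qed

text \<open>A larger value to the right of the ascent would complete a $123$.\<close>

lemma larger_before_ascent:
  assumes "q permutes {1..n}" "avoids_pattern n q [1, 2, 3]"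
    "1 \<le> i" "i < j" "q i < q j" "q j < v" "v \<le> n"
  shows "v \<in> q ` {1..<j}"
proof -
  have "v \<in> q ` {1..n}"
    using assms by (simp add: permutes_image)
  then obtain k where k: "1 \<le> k" "k \<le> n" "v = q k" by auto
  moreover have "\<not> j < k" "k \<noteq> j"
    using avoids_123D[OF assms(2-4)] assms k by auto
  ultimately show ?thesis by auto
qed

section \<open>Entries with smaller entries to their right\<close>

text \<open>Avoiding $312$ forces the smaller entries to the right of a given one to decrease.\<close>

lemma smaller_later_decreasing:
  assumes "avoids_pattern n p [3, 1, 2]" "1 \<le> i" "i < j" "i < k" "j \<le> n" "k \<le> n"
    "p j < p k" "p k < p i"
  shows "k < j"
  using avoids_312D[OF assms(1), of i j k] assms by (metis linorder_neqE_nat order_less_irrefl)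

lemma no_three_smaller_later:
  assumes "avoids_pattern n p [3, 1, 2]" "avoids_pattern n p [4, 3, 2, 1]"
    "1 \<le> i" "u < v" "v < w" "w < p i" "{u, v, w} \<subseteq> p ` {i<..n}"
  shows False
proof -
  from assms obtain a b c where abc: "i < a" "a \<le> n" "u = p a" "i < b" "b \<le> n" "v = p b"
    "i < c" "c \<le> n" "w = p c" by auto
  have "c < b"
    by (rule smaller_later_decreasing[OF assms(1), of i]) (use assms abc in auto)
  moreover have "b < a"
    by (rule smaller_later_decreasing[OF assms(1), of i]) (use assms abc in auto)
  ultimately show False
    using avoids_4321D[OF assms(2), of i c b a] assms abc by auto
qed

lemma entry_le_add_2:
  assumes p: "p permutes {1..n}"
    and av: "avoids_pattern n p [3, 1, 2]" "avoids_pattern n p [4, 3, 2, 1]"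
    and i: "1 \<le> i" "i \<le> n"
  shows "p i \<le> i + 2"
proof (rule ccontr)
  assume big: "\<not> p i \<le> i + 2"
  define S where "S = {1..<p i} - p ` {1..<i}"
  \<comment> \<open>At least \<open>i + 2\<close> values lie below \<open>p i\<close>, and at most \<open>i - 1\<close> of them come before position \<open>i\<close>.\<close>
  have "card (p ` {1..<i}) \<le> i - 1"
    using card_image_le[of "{1..<i}" p] by simp
  moreover have "card {1..<p i} - card (p ` {1..<i}) \<le> card S"
    unfolding S_def by (rule diff_card_le_card_Diff) simp
  ultimately have "3 \<le> card S"
    using big i by simp
  then obtain T where T: "T \<subseteq> S" "card T = 3"
    by (meson obtain_subset_with_card_n)
  have fin: "finite T"
    using T(2) by (metis card.infinite zero_neq_numeral)
  define xs where "xs = sorted_list_of_set T"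
  have xs: "set xs = T" "length xs = 3" "sorted_wrt (<) xs"
    using fin T(2) by (simp_all add: xs_def)
  obtain u v w where "xs = [u, v, w]"
    using xs(2) by (auto simp: numeral_eq_Suc length_Suc_conv)
  with xs have uvw: "{u, v, w} = T" "u < v" "v < w"
    by auto
  have "S \<subseteq> p ` {i<..n}"
  proof
    fix x assume x: "x \<in> S"
    have "p i \<le> n"
      using permutes_in_image[OF p, of i] i by simp
    then have "x \<in> p ` {1..n}"
      using x p by (simp add: S_def permutes_image)
    then obtain k where "1 \<le> k" "k \<le> n" "x = p k" by auto
    with x show "x \<in> p ` {i<..n}"
      unfolding S_def by (cases k i rule: linorder_cases) auto
  qed
  with uvw T have "{u, v, w} \<subseteq> p ` {i<..n}" "w < p i"
    by (auto simp: S_def)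
  with no_three_smaller_later[OF av i(1)] uvw show False by blast
qed

section \<open>The entry 1 is not in the last position\<close>

text \<open>
  The square roots of a reversal that a permutation with at most two smaller entries after each entry could
  have: the least point goes up to the greatest in two steps of size at most $2$. For five points,
  both steps have size $2$ and collide with the fixed middle point; for four points, both
  choices for the first step lead to a $312$.
\<close>

lemma reversal_root_bound:
  assumes p: "p permutes {1..n}"
    and av: "avoids_pattern n p [3, 1, 2]" "avoids_pattern n p [4, 3, 2, 1]"
    and le: "a + m \<le> n" and inv: "\<And>x. a < x \<Longrightarrow> x \<le> a + m \<Longrightarrow> a < p x \<and> p x \<le> a + m"
    and dec: "\<And>x y. a < x \<Longrightarrow> x < y \<Longrightarrow> y \<le> a + m \<Longrightarrow> p (p y) < p (p x)"
  shows "m \<le> 3"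
proof (rule ccontr)
  assume "\<not> m \<le> 3"
  then have m4: "4 \<le> m" by simp
  have up: "p x \<le> x + 2" if "a < x" "x \<le> a + m" for x
    using entry_le_add_2[OF p av, of x] that le by simp
  have inj: "p x = p y \<longleftrightarrow> x = y" for x y
    using permutes_inj[OF p] by (simp add: inj_eq)
  have top: "p (p (a + 1)) = a + m"
  proof -
    have "p (p x) + (x - (a + 1)) \<le> p (p (a + 1))" if "a + 1 \<le> x" "x \<le> a + m" for x
      using that
    proof (induction x rule: dec_induct)
      case (step x)
      then show ?case using dec[of x "Suc x"] by simp
    qed simp
    from this[of "a + m"] have "p (p (a + m)) + (a + m - (a + 1)) \<le> p (p (a + 1))"
      using m4 by simp
    moreover have "a < p (p (a + m))" "p (p (a + 1)) \<le> a + m"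
      using inv[of "p (a + m)"] inv[of "a + m"] inv[of "p (a + 1)"] inv[of "a + 1"] m4 by simp_all
    ultimately show ?thesis using m4 by linarith
  qed
  have "m \<le> 5"
    using up[of "a + 1"] up[of "p (a + 1)"] inv[of "a + 1"] top m4 by simp
  then consider "m = 4" | "m = 5" using m4 by linarith
  then show False
  proof cases
    case 1
    have q: "p (p (a + 2)) = a + 3" "p (p (a + 3)) = a + 2" "p (p (a + 4)) = a + 1"
      using dec[of "a + 1" "a + 2"] dec[of "a + 2" "a + 3"] dec[of "a + 3" "a + 4"] top
        inv[of "p (a + 4)"] inv[of "a + 4"] 1 by simp_all
    have "p (a + 1) \<noteq> a + 1"
      using top 1 by auto
    then consider "p (a + 1) = a + 2" | "p (a + 1) = a + 3"
      using up[of "a + 1"] inv[of "a + 1"] 1 by force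
    then show False
    proof cases
      case 1
      then have "p (a + 2) = a + 4" "p (a + 4) = a + 3" "p (a + 3) = a + 1"
        using top q \<open>m = 4\<close> by auto
      then show False
        using avoids_312D[OF av(1), of "a + 2" "a + 3" "a + 4"] le \<open>m = 4\<close> by simp
    next
      case 2
      then have "p (a + 3) = a + 4" "p (a + 4) = a + 2" "p (a + 2) = a + 1"
        using top q \<open>m = 4\<close> by auto
      then show False
        using avoids_312D[OF av(1), of "a + 1" "a + 2" "a + 4"] 2 le \<open>m = 4\<close> by simp
    qed
  next
    case 2
    have q: "p (p (a + 3)) = a + 3"
      using dec[of "a + 1" "a + 2"] dec[of "a + 2" "a + 3"] dec[of "a + 3" "a + 4"]
        dec[of "a + 4" "a + 5"] top inv[of "p (a + 5)"] inv[of "a + 5"] 2 by simp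
    have "p (a + 1) = a + 3"
      using up[of "a + 1"] up[of "p (a + 1)"] inv[of "a + 1"] top 2 by simp
    with top q 2 have "p (a + 5) = p (a + 1)" by simp
    then show False by (simp add: inj)
  qed
qed

lemma early_one_bound:
  assumes p: "p permutes {1..n}"
    and av: "avoids_pattern n p [3, 1, 2]" "avoids_pattern n p [4, 3, 2, 1]"
    and sq: "avoids_pattern n (p \<circ> p) [1, 2, 3]"
    and j: "1 \<le> j" "j < n" "p j = 1"
  shows "n \<le> 6"
proof -
  have inj: "p x = p y \<longleftrightarrow> x = y" for x y
    using permutes_inj[OF p] by (simp add: inj_eq)
  have rng: "1 \<le> p x \<and> p x \<le> n" if "1 \<le> x" "x \<le> n" for x
    using permutes_in_image[OF p, of x] that by simp
  have sep: "p x < p y" if "1 \<le> x" "x \<le> j" "j < y" "y \<le> n" for x y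
  proof (rule ccontr)
    assume *: "\<not> p x < p y"
    moreover have "p x \<noteq> p y" "p y \<noteq> p j" "1 \<le> p y"
      using inj rng[of y] that by auto
    ultimately have "x < j" "p j < p y" "p y < p x"
      using that j(3) by (auto simp: order_le_less)
    then show False
      using avoids_312D[OF av(1), of x j y] that by simp
  qed
  \<comment> \<open>The \<open>n - j\<close> entries after position \<open>j\<close> all lie above \<open>p x\<close>, and at most \<open>n - p x\<close> values do.\<close>
  have low: "p x \<le> j" if "1 \<le> x" "x \<le> j" for x
  proof -
    have "p ` {j<..n} \<subseteq> {p x<..n}"
      using sep[OF that] rng by force
    then have "card (p ` {j<..n}) \<le> card {p x<..n}"
      by (intro card_mono) auto
    moreover have "card (p ` {j<..n}) = n - j"
      using permutes_inj_on[OF p] by (simp add: card_image)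
    ultimately show ?thesis using rng[of x] that j by simp
  qed
  have high: "j < p y" if "j < y" "y \<le> n" for y
  proof -
    have "p ` {1..j} \<subseteq> {1..<p y}"
      using sep that rng j by force
    then have "card (p ` {1..j}) \<le> card {1..<p y}"
      by (intro card_mono) auto
    moreover have "card (p ` {1..j}) = j"
      using permutes_inj_on[OF p] by (simp add: card_image)
    ultimately show ?thesis using rng[of y] that j by simp
  qed
  have q_low: "1 \<le> p (p x) \<and> p (p x) \<le> j" if "1 \<le> x" "x \<le> j" for x
    using low[of x] low[of "p x"] rng[of x] rng[of "p x"] that j by simp
  have q_high: "j < p (p x) \<and> p (p x) \<le> n" if "j < x" "x \<le> n" for x
    using high[of x] high[of "p x"] rng[of x] rng[of "p x"] that j by simp
  have "j \<le> 3"
  proof (rule reversal_root_bound[OF p av, where a = 0])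
    show "0 < p x \<and> p x \<le> 0 + j" if "0 < x" "x \<le> 0 + j" for x
      using low[of x] rng[of x] that j by simp
    fix x y assume xy: "0 < x" "x < y" "y \<le> 0 + j"
    show "p (p y) < p (p x)"
    proof (rule ccontr)
      assume "\<not> p (p y) < p (p x)"
      moreover have "p (p x) \<noteq> p (p y)"
        using xy by (simp add: inj)
      ultimately show False
        using avoids_123D[OF sq, of x y n] q_low[of y] q_high[of n] xy j by simp
    qed
  qed (use j in simp)
  moreover have "n - j \<le> 3"
  proof (rule reversal_root_bound[OF p av, where a = j])
    show "j < p x \<and> p x \<le> j + (n - j)" if "j < x" "x \<le> j + (n - j)" for x
      using high[of x] rng[of x] that j by simp
    fix x y assume xy: "j < x" "x < y" "y \<le> j + (n - j)"
    show "p (p y) < p (p x)"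
    proof (rule ccontr)
      assume "\<not> p (p y) < p (p x)"
      moreover have "p (p x) \<noteq> p (p y)"
        using xy by (simp add: inj)
      ultimately show False
        using avoids_123D[OF sq, of 1 x y] q_low[of 1] q_high[of x] xy j by simp
    qed
  qed (use j in simp)
  ultimately show ?thesis by simp
qed

section \<open>The entry 1 is in the last position\<close>

text \<open>
  If \<open>u\<close>, \<open>v\<close> and the final $1$ all come after position \<open>i\<close>, they cannot all be smaller than
  \<open>p i\<close>. So \<open>p i\<close> is at most the second least unused value above $1$.
\<close>

lemma entry_le_second_unused:
  assumes p: "p permutes {1..n}"
    and av: "avoids_pattern n p [3, 1, 2]" "avoids_pattern n p [4, 3, 2, 1]"
    and one: "p n = 1"
    and i: "1 \<le> i" "i < n" and uv: "1 < u" "u < v" "v \<le> n"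
    and unused: "u \<notin> p ` {1..<i}" "v \<notin> p ` {1..<i}"
  shows "p i \<le> v"
proof (rule ccontr)
  assume big: "\<not> p i \<le> v"
  have later: "x \<in> p ` {i<..n}" if x: "1 < x" "x < p i" "x \<le> n" "x \<notin> p ` {1..<i}" for x
  proof -
    have "x \<in> p ` {1..n}"
      using x p by (simp add: permutes_image)
    then obtain k where "1 \<le> k" "k \<le> n" "x = p k" by auto
    with x show ?thesis by (cases k i rule: linorder_cases) auto
  qed
  have "{1, u, v} \<subseteq> p ` {i<..n}"
  proof -
    have "p n \<in> p ` {i<..n}"
      using i(2) by simp
    moreover have "u \<in> p ` {i<..n}" "v \<in> p ` {i<..n}"
      using later[of u] later[of v] uv unused big by simp_all
    ultimately show ?thesis using one by simp
  qed
  then show False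
    using no_three_smaller_later[OF av i(1) uv(1,2)] big by simp
qed

text \<open>
  The case distinction follows the possible values of \<open>p 1, p 2, ...\<close>. In every branch
  that does not exhibit a $123$ of the square outright, the square has an ascent ending at a position \<open>j\<close>,
  and some larger value, or one of two such values, cannot stand at any of the positions
  before \<open>j\<close>.
\<close>

lemma final_one_bound:
  assumes p: "p permutes {1..n}"
    and av: "avoids_pattern n p [3, 1, 2]" "avoids_pattern n p [4, 3, 2, 1]"
    and sq: "avoids_pattern n (p \<circ> p) [1, 2, 3]"
    and one: "p n = 1"
  shows "n \<le> 6"
proof (rule ccontr)
  assume "\<not> n \<le> 6"
  then have n: "7 \<le> n" by simp
  have inj: "p x = p y \<longleftrightarrow> x = y" for x y
    using permutes_inj[OF p] by (simp add: inj_eq)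
  have gt1: "1 < p i" if "1 \<le> i" "i < n" for i
    using permutes_in_image[OF p, of i] inj[of i n] one that by (cases "p i = 1") auto
  have initial: "{1..<1::nat} = {}" "{1..<2::nat} = {1}" "{1..<3::nat} = {1, 2}"
    "{1..<4::nat} = {1, 2, 3}" "{1..<5::nat} = {1, 2, 3, 4}"
    by auto
  note le = entry_le_second_unused[OF p av one]
  have q: "p \<circ> p permutes {1..n}"
    using p by (simp add: permutes_compose)
  have larger: "v \<in> (\<lambda>x. p (p x)) ` {1..<j}"
    if "1 \<le> i" "i < j" "p (p i) < p (p j)" "p (p j) < v" "v \<le> n" for i j v
    using larger_before_ascent[OF q sq that(1,2)] that(3-) by (simp add: comp_def)
  note no123 = avoids_123D[OF sq, unfolded comp_def]
  have "1 < p 1" "p 1 \<le> 3"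
    using gt1[of 1] le[of 1 2 3] n by simp_all
  then consider "p 1 = 2" | "p 1 = 3" by linarith
  then show False
  proof cases
    case p1: 1
    have "1 < p 2" "p 2 \<le> 4" "p 2 \<noteq> 2"
      using gt1[of 2] le[of 2 3 4] n p1 inj[of 2 1]
      by (simp_all add: initial del: One_nat_def)
    then consider "p 2 = 3" | "p 2 = 4" by linarith
    then show False
    proof cases
      case p2: 1
      have "1 < p 3" "p 3 \<le> 5" "p 3 \<noteq> 2" "p 3 \<noteq> 3"
        using gt1[of 3] le[of 3 4 5] n p1 p2 inj[of 3 1] inj[of 3 2] by (simp_all add: initial del: One_nat_def)
      then show False
        using larger[of 1 2 6] n p1 p2 by (simp add: initial del: One_nat_def)
    next
      case p2: 2
      have "1 < p 3" "p 3 \<le> 5" "p 3 \<noteq> 2" "p 3 \<noteq> 4"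
        using gt1[of 3] le[of 3 3 5] n p1 p2 inj[of 3 1] inj[of 3 2] by (simp_all add: initial del: One_nat_def)
      then consider "p 3 = 3" | "p 3 = 5" by linarith
      then show False
      proof cases
        case p3: 1
        have "1 < p 4" "p 4 \<le> 6" "p 4 \<noteq> 2" "p 4 \<noteq> 3" "p 4 \<noteq> 4"
          using gt1[of 4] le[of 4 5 6] n p1 p2 p3 inj[of 4 1] inj[of 4 2] inj[of 4 3]
          by (simp_all add: initial del: One_nat_def)
        then show False
          using larger[of 1 2 7] n p1 p2 by (simp add: initial del: One_nat_def)
      next
        case p3: 2
        have "1 < p 4" "p 4 \<le> 6" "p 4 \<noteq> 2" "p 4 \<noteq> 4" "p 4 \<noteq> 5"
          using gt1[of 4] le[of 4 3 6] n p1 p2 p3 inj[of 4 1] inj[of 4 2] inj[of 4 3]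
          by (simp_all add: initial del: One_nat_def)
        then consider "p 4 = 3" | "p 4 = 6" by linarith
        then show False
        proof cases
          case 1
          then show False
            using larger[of 2 4 6] larger[of 2 4 7] n p1 p2 p3 by (simp add: initial del: One_nat_def)
        next
          case 2
          then show False
            using larger[of 1 2 7] n p1 p2 by (simp add: initial del: One_nat_def)
        qed
      qed
    qed
  next
    case p1: 2
    have "1 < p 2" "p 2 \<le> 4" "p 2 \<noteq> 3"
      using gt1[of 2] le[of 2 2 4] n p1 inj[of 2 1]
      by (simp_all add: initial del: One_nat_def)
    then consider "p 2 = 2" | "p 2 = 4" by linarith
    then show False
    proof cases
      case p2: 1
      have "1 < p 3" "p 3 \<le> 5" "p 3 \<noteq> 2" "p 3 \<noteq> 3"
        using gt1[of 3] le[of 3 4 5] n p1 p2 inj[of 3 1] inj[of 3 2] by (simp_all add: initial del: One_nat_def)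
      then consider "p 3 = 4" | "p 3 = 5" by linarith
      then show False
      proof cases
        case p3: 1
        have "1 < p 4" "p 4 \<le> 6" "p 4 \<noteq> 2" "p 4 \<noteq> 3" "p 4 \<noteq> 4"
          using gt1[of 4] le[of 4 5 6] n p1 p2 p3 inj[of 4 1] inj[of 4 2] inj[of 4 3]
          by (simp_all add: initial del: One_nat_def)
        then show False
          using larger[of 2 3 7] n p1 p2 p3 by (simp add: initial del: One_nat_def)
      next
        case p3: 2
        have "1 < p 4" "p 4 \<le> 6" "p 4 \<noteq> 2" "p 4 \<noteq> 3" "p 4 \<noteq> 5"
          using gt1[of 4] le[of 4 4 6] n p1 p2 p3 inj[of 4 1] inj[of 4 2] inj[of 4 3]
          by (simp_all add: initial del: One_nat_def)
        then consider "p 4 = 4" | "p 4 = 6" by linarith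
        then show False
        proof cases
          case 1
          then show False
            using larger[of 2 4 6] larger[of 2 4 7] n p1 p2 p3 by (simp add: initial del: One_nat_def)
        next
          case p4: 2
          have "1 < p 5" "p 5 \<le> 7" "p 5 \<noteq> 2" "p 5 \<noteq> 3" "p 5 \<noteq> 5" "p 5 \<noteq> 6"
            using gt1[of 5] le[of 5 4 7] n p1 p2 p3 p4 inj[of 5 1] inj[of 5 2] inj[of 5 3] inj[of 5 4]
            by (simp_all add: initial del: One_nat_def)
          then consider "p 5 = 4" | "p 5 = 7" by linarith
          then show False
          proof cases
            case 1
            then show False
              using larger[of 2 3 6] n p1 p2 p3 by (simp add: initial del: One_nat_def)
          next
            case p5: 2
            \<comment> \<open>The ascent from $5$ to $7$ at the positions $1$ and $3$ leaves no place for $8$.\<close>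
            have "\<not> 8 \<le> n"
              using larger[of 1 3 8] n p1 p2 p3 p5 by (auto simp: initial simp del: One_nat_def)
            with n have n7: "n = 7" by simp
            have "1 < p 6" "p 6 \<le> 7" "p 6 \<noteq> 2" "p 6 \<noteq> 3" "p 6 \<noteq> 5" "p 6 \<noteq> 6" "p 6 \<noteq> 7"
              using gt1[of 6] permutes_in_image[OF p, of 6] n7 p1 p2 p3 p4 p5
                inj[of 6 1] inj[of 6 2] inj[of 6 3] inj[of 6 4] inj[of 6 5] by simp_all
            then have "p 6 = 4" by linarith
            then show False
              using larger[of 2 4 6] n p1 p2 p3 p4 p5 by (simp add: initial del: One_nat_def)
          qed
        qed
      qed
    next
      case p2: 2
      have "1 < p 3" "p 3 \<le> 5" "p 3 \<noteq> 3" "p 3 \<noteq> 4"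
        using gt1[of 3] le[of 3 2 5] n p1 p2 inj[of 3 1] inj[of 3 2] by (simp_all add: initial del: One_nat_def)
      then consider "p 3 = 2" | "p 3 = 5" by linarith
      then show False
      proof cases
        case 1
        then show False
          using larger[of 1 3 5] larger[of 1 3 6] n p1 p2 by (simp add: initial del: One_nat_def)
      next
        case p3: 2
        have "1 < p 4" "p 4 \<le> 6" "p 4 \<noteq> 3" "p 4 \<noteq> 4" "p 4 \<noteq> 5"
          using gt1[of 4] le[of 4 2 6] n p1 p2 p3 inj[of 4 1] inj[of 4 2] inj[of 4 3]
          by (simp_all add: initial del: One_nat_def)
        then consider "p 4 = 2" | "p 4 = 6" by linarith
        then show False
        proof cases
          case p4: 1
          have "1 < p 5" "p 5 \<le> 7" "p 5 \<noteq> 2" "p 5 \<noteq> 3" "p 5 \<noteq> 4" "p 5 \<noteq> 5"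
            using gt1[of 5] le[of 5 6 7] n p1 p2 p3 p4 inj[of 5 1] inj[of 5 2] inj[of 5 3] inj[of 5 4]
            by (simp_all add: initial del: One_nat_def)
          then consider "p 5 = 6" | "p 5 = 7" by linarith
          then show False
          proof cases
            case p5: 1
            have "1 < p 6" "p 6 \<noteq> 2" "p 6 \<noteq> 3" "p 6 \<noteq> 4" "p 6 \<noteq> 5" "p 6 \<noteq> 6"
              using gt1[of 6] n p1 p2 p3 p4 p5
                inj[of 6 1] inj[of 6 2] inj[of 6 3] inj[of 6 4] inj[of 6 5] by simp_all
            then have "7 \<le> p 6" by linarith
            then show False
              using no123[of 2 4 5] n p2 p4 p5 by simp
          next
            case p5: 2
            \<comment> \<open>The ascent from $5$ to $7$ at the positions $1$ and $3$ leaves no place for $8$.\<close>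
            have "\<not> 8 \<le> n"
              using larger[of 1 3 8] n p1 p2 p3 p4 p5 by (auto simp: initial simp del: One_nat_def)
            with n have n7: "n = 7" by simp
            have "1 < p 6" "p 6 \<le> 7" "p 6 \<noteq> 2" "p 6 \<noteq> 3" "p 6 \<noteq> 4" "p 6 \<noteq> 5" "p 6 \<noteq> 7"
              using gt1[of 6] permutes_in_image[OF p, of 6] n7 p1 p2 p3 p4 p5
                inj[of 6 1] inj[of 6 2] inj[of 6 3] inj[of 6 4] inj[of 6 5] by simp_all
            then have "p 6 = 6" by linarith
            then show False
              using no123[of 2 4 6] n p2 p4 by simp
          qed
        next
          case p4: 2
          have "1 < p 5" "p 5 \<le> 7" "p 5 \<noteq> 3" "p 5 \<noteq> 4" "p 5 \<noteq> 5" "p 5 \<noteq> 6"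
            using gt1[of 5] le[of 5 2 7] n p1 p2 p3 p4 inj[of 5 1] inj[of 5 2] inj[of 5 3] inj[of 5 4]
            by (simp_all add: initial del: One_nat_def)
          then consider "p 5 = 2" | "p 5 = 7" by linarith
          then show False
          proof cases
            case p5: 1
            have "1 < p 6" "p 6 \<noteq> 2" "p 6 \<noteq> 3" "p 6 \<noteq> 4" "p 6 \<noteq> 5" "p 6 \<noteq> 6"
              using gt1[of 6] n p1 p2 p3 p4 p5
                inj[of 6 1] inj[of 6 2] inj[of 6 3] inj[of 6 4] inj[of 6 5] by simp_all
            then have "7 \<le> p 6" by linarith
            then show False
              using no123[of 1 2 4] n p1 p2 p3 p4 by simp
          next
            case 2
            then show False
              using no123[of 1 2 3] n p1 p2 p3 p4 by simp
          qed
        qed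
      qed
    qed
  qed
qed

theorem theorem4p1:
  fixes n :: nat
  assumes "n \<ge> 7"
  shows "avoid_count n {[3, 1, 2], [4, 3, 2, 1]} [1, 2, 3] = 0 \<and>
    \<not> (\<exists>p. p permutes {1..n} \<and> avoids_pattern n p [3, 1, 2] \<and> avoids_pattern n p [4, 3, 2, 1] \<and>
         avoids_pattern n (p \<circ> p) [1, 2, 3])"
proof -
  have none: "\<not> (\<exists>p. p permutes {1..n} \<and> avoids_pattern n p [3, 1, 2] \<and>
    avoids_pattern n p [4, 3, 2, 1] \<and> avoids_pattern n (p \<circ> p) [1, 2, 3])"
  proof
    assume "\<exists>p. p permutes {1..n} \<and> avoids_pattern n p [3, 1, 2] \<and>
      avoids_pattern n p [4, 3, 2, 1] \<and> avoids_pattern n (p \<circ> p) [1, 2, 3]"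
    then obtain p where p: "p permutes {1..n}" "avoids_pattern n p [3, 1, 2]"
      "avoids_pattern n p [4, 3, 2, 1]" "avoids_pattern n (p \<circ> p) [1, 2, 3]" by blast
    have "1 \<in> p ` {1..n}"
      using assms p(1) by (simp add: permutes_image)
    then obtain j where j: "1 \<le> j" "j \<le> n" "p j = 1" by auto
    have "n \<le> 6"
    proof (cases "j = n")
      case True
      with final_one_bound[OF p] j show ?thesis by simp
    next
      case False
      with early_one_bound[OF p, of j] j show ?thesis by simp
    qed
    with assms show False by simp
  qed
  then have "{p. p permutes {1..n} \<and> (\<forall>\<tau>\<in>{[3, 1, 2], [4, 3, 2, 1]}. avoids_pattern n p \<tau>) \<and>
    avoids_pattern n (p \<circ> p) [1, 2, 3]} = {}" by blast
  then have "avoid_count n {[3, 1, 2], [4, 3, 2, 1]} [1, 2, 3] = 0"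
    unfolding avoid_count_def by (simp only: card.empty)
  with none show ?thesis by blast
qed

end
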